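(* Let $r$ and $k$ be positive integers and $\sigma$ a real number, and let $g$ be a (candidate) bipartite subgraph of a finite weighted bipartite graph $G_t$, centered at a user vertex $u_q\in U(g)$. If a user vertex $u_i\in U(g)$ satisfies $dist(u_i,u_q)>2r$, where $dist$ is the shortest-path distance in $g$ (taken to be $+\infty$ if no path exists), then $u_i$ can be safely pruned from $g$; that is, no subgraph $h\subseteq g$ that is a $(k,r,\sigma)$-bitruss with center $u_q$ contains $u_i$.
   Context: A bipartite graph $G$ has two disjoint finite vertex sets $U(G)$ (users) and $L(G)$ (items), and edges $e_{u,v}\in E(G)$ with $u\in U(G)$, $v\in L(G)$; each edge carries a positive integer weight $w_{u,v}$. Subgraphs inherit edge weights. A butterfly $\Join(u_i,u_j,v_a,v_b)$ in a bipartite graph $g$ consists of two distinct users $u_i,u_j$ and two distinct items $v_a,v_b$ such that all four edges between them lie in $E(g)$. The support $sup(e)$ of an edge $e$ in $g$ is the number of butterflies of $g$ containing $e$. A wedge $\angle(u_i,v,u_j)$ in $g$ is a path $u_i - v - u_j$ in $g$ with $u_i\neq u_j$ users and $v$ an item; its weight is $\min\{w_{u_i,v},w_{u_j,v}\}$. The score of a butterfly is $w_{\Join(u_i,u_j,v_a,v_b)}=\min\{w_{u_i,v_a},w_{u_j,v_a}\}\cdot\min\{w_{u_i,v_b},w_{u_j,v_b}\}$. The user relationship score $score_{u_i,u_j}(g)$ is the sum of the scores of all butterflies of $g$ containing both $u_i$ and $u_j$ (each unordered pair $\{v_a,v_b\}$ counted once). A $(k,r,\sigma)$-bitruss with center $u_c$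 is a connected bipartite subgraph $h$ of $G_t$ with $u_c\in U(h)$ such that: (Support) every edge of $h$ has support at least $k$ in $h$; (Radius) every user $u_i\in U(h)$ satisfies $dist(u_c,u_i)\le 2r$, where $dist$ is shortest-path distance (number of edges) in $h$; (Score) for every wedge $\angle(u_i,v,u_j)$ in $h$, $score_{u_i,u_j}(h)\ge\sigma$. *)

theory Defs
  imports "Graph_Theory.Graph_Theory"
begin

record 'a bigraph =
  users :: "'a set"
  items :: "'a set"
  edges :: "('a \<times> 'a) set"  \<comment> \<open>pairs (user, item)\<close>
  wt :: "'a \<times> 'a \<Rightarrow> nat"  \<comment> \<open>only the values on \<open>edges\<close> matter\<close>

locale bipartite_graph =
  fixes G :: "'a bigraph"
  assumes finite_users: "finite (users G)"
    and finite_items: "finite (items G)"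
    and disjoint: "users G \<inter> items G = {}"
    and edges_subset: "edges G \<subseteq> users G \<times> items G"
    and wt_pos: "\<And>e. e \<in> edges G \<Longrightarrow> 0 < wt G e"

definition bipartite_subgraph :: "'a bigraph \<Rightarrow> 'a bigraph \<Rightarrow> bool" where
  "bipartite_subgraph h g \<longleftrightarrow> bipartite_graph h \<and> bipartite_graph g \<and>
     users h \<subseteq> users g \<and> items h \<subseteq> items g \<and> edges h \<subseteq> edges g \<and>
     (\<forall>e \<in> edges h. wt h e = wt g e)"

text \<open>The underlying undirected graph, as a symmetric digraph: every edge gives one arc in each
  direction.\<close>

definition digraph_of :: "'a bigraph \<Rightarrow> 'a pair_pre_digraph" where
  "digraph_of g = \<lparr> pverts = users g \<union> items g, parcs = edges g \<union> (edges g)\<inverse> \<rparr>"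

lemma (in bipartite_graph) wf_digraph_of: "wf_digraph (with_proj (digraph_of G))"
  using edges_subset by unfold_locales (auto simp: digraph_of_def)

definition connected_bigraph :: "'a bigraph \<Rightarrow> bool" where
  "connected_bigraph g \<longleftrightarrow> connected (with_proj (digraph_of g))"

text \<open>Least number of edges of a walk between two vertices (every arc costs 1); it is
  \<open>\<infinity>\<close> if there is no walk.\<close>

definition gdist :: "'a bigraph \<Rightarrow> 'a \<Rightarrow> 'a \<Rightarrow> ereal" where
  "gdist g x y = wf_digraph.\<mu> (with_proj (digraph_of g)) (\<lambda>_. 1) x y"

text \<open>A butterfly is encoded by its unordered pair of users and its unordered pair of items, so
  that each butterfly is counted once.\<close>

definition butterflies :: "'a bigraph \<Rightarrow> ('a set \<times> 'a set) set" where
  "butterflies g = {(A, B). A \<subseteq> users g \<and> B \<subseteq> items g \<and> card A = 2 \<and> card B = 2 \<and>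
     A \<times> B \<subseteq> edges g}"

definition support :: "'a bigraph \<Rightarrow> 'a \<times> 'a \<Rightarrow> nat" where
  "support g e = card {(A, B) \<in> butterflies g. e \<in> A \<times> B}"

definition wedge :: "'a bigraph \<Rightarrow> 'a \<Rightarrow> 'a \<Rightarrow> 'a \<Rightarrow> bool" where
  "wedge g u v u' \<longleftrightarrow> u \<noteq> u' \<and> (u, v) \<in> edges g \<and> (u', v) \<in> edges g"

text \<open>The inner minimum ranges over the two users of the butterfly: it is the weight of the wedge
  at the item \<open>v\<close>; see \<open>butterfly_score_eq\<close>.\<close>

definition butterfly_score :: "'a bigraph \<Rightarrow> 'a set \<times> 'a set \<Rightarrow> nat" where
  "butterfly_score g = (\<lambda>(A, B). \<Prod>v\<in>B. Min ((\<lambda>u. wt g (u, v)) ` A))"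

lemma butterfly_score_eq:
  assumes "v \<noteq> v'"
  shows "butterfly_score g ({u, u'}, {v, v'}) =
    min (wt g (u, v)) (wt g (u', v)) * min (wt g (u, v')) (wt g (u', v'))"
  using assms by (simp add: butterfly_score_def)

definition user_score :: "'a bigraph \<Rightarrow> 'a \<Rightarrow> 'a \<Rightarrow> nat" where
  "user_score g u u' = (\<Sum>b \<in> {(A, B) \<in> butterflies g. u \<in> A \<and> u' \<in> A}. butterfly_score g b)"

definition bitruss ::
    "'a bigraph \<Rightarrow> nat \<Rightarrow> nat \<Rightarrow> real \<Rightarrow> 'a \<Rightarrow> 'a bigraph \<Rightarrow> bool" where
  "bitruss G k r \<sigma> c h \<longleftrightarrow>
     bipartite_subgraph h G \<and> connected_bigraph h \<and> c \<in> users h \<and>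
     (\<forall>e \<in> edges h. k \<le> support h e) \<and>
     (\<forall>u \<in> users h. gdist h c u \<le> ereal (2 * real r)) \<and>
     (\<forall>u v u'. wedge h u v u' \<longrightarrow> \<sigma> \<le> real (user_score h u u'))"

end

theory Submission
  imports Defs
begin

text \<open>A subgraph has fewer walks, so distances can only grow on passing from \<open>g\<close>
  to \<open>h\<close> (\<open>gdist_subgraph_le\<close>). A user farther than \<open>2 * r\<close>
  from the center in \<open>g\<close> is thus too far in every such \<open>h\<close>, against the
  radius condition. As \<open>gdist\<close> is defined by directed walks, the two orders of its
  arguments are related by reversing walks (\<open>gdist_commute_le\<close>).\<close>

text \<open>Induction step for reversal: the first arc of a walk, swapped, becomes the last.
  \<open>cas\<close> only checks that consecutive endpoints match, so \<open>G\<close> may be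
  arbitrary here.\<close>

lemma cas_append_swap:
  "pre_digraph.cas (with_proj G) u p (snd e) \<Longrightarrow>
    pre_digraph.cas (with_proj G) u (p @ [prod.swap e]) (fst e)"
  by (induction p arbitrary: u) (auto simp: pre_digraph.cas.simps)

lemma cas_rev_swap:
  "pre_digraph.cas (with_proj G) u p v \<Longrightarrow>
    pre_digraph.cas (with_proj G) v (rev (map prod.swap p)) u"
  by (induction p arbitrary: u) (auto simp: pre_digraph.cas.simps dest: cas_append_swap)

text \<open>The arc set of \<open>digraph_of g\<close> is closed under swapping, so the reversed
  arcs lie in the graph again.\<close>

lemma awalk_rev_swap:
  assumes "bipartite_graph g" and walk: "pre_digraph.awalk (with_proj (digraph_of g)) u p v"
  shows "pre_digraph.awalk (with_proj (digraph_of g)) v (rev (map prod.swap p)) u"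
proof -
  interpret wf_digraph "with_proj (digraph_of g)"
    using assms(1) by (rule bipartite_graph.wf_digraph_of)
  \<comment> \<open>\<open>awalk\<close> requires its start to be a vertex, and the reversed walk
    starts at \<open>v\<close>.\<close>
  have "v \<in> verts (with_proj (digraph_of g))"
    using walk by (rule awalk_last_in_verts)
  then show ?thesis
    using walk cas_rev_swap[of "digraph_of g" u p v] by (auto simp: pre_digraph.awalk_def digraph_of_def)
qed

text \<open>Each walk from \<open>u\<close> to \<open>v\<close> reverses to one from
  \<open>v\<close> to \<open>u\<close> of equal cost, since all arcs cost 1.\<close>

lemma gdist_commute_le:
  assumes "bipartite_graph g"
  shows "gdist g v u \<le> gdist g u v"
proof -
  interpret wf_digraph "with_proj (digraph_of g)"
    using assms by (rule bipartite_graph.wf_digraph_of)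
  have cost: "awalk_cost (\<lambda>_. 1) (rev (map prod.swap p)) = awalk_cost (\<lambda>_. 1) p" for p
    by (induction p) auto
  show ?thesis
    unfolding gdist_def \<mu>_def
    by (rule INF_mono) (metis awalk_rev_swap assms cost mem_Collect_eq order_refl)
qed

text \<open>The infimum for \<open>g\<close> ranges over a superset of the walks of
  \<open>h\<close>, at the same costs; if \<open>h\<close> has no walk, its infimum is
  \<infinity>.\<close>

lemma gdist_subgraph_le:
  assumes "bipartite_subgraph h g"
  shows "gdist g u v \<le> gdist h u v"
proof -
  interpret g: wf_digraph "with_proj (digraph_of g)"
    using assms by (auto simp: bipartite_subgraph_def bipartite_graph.wf_digraph_of)
  interpret h: wf_digraph "with_proj (digraph_of h)"
    using assms by (auto simp: bipartite_subgraph_def bipartite_graph.wf_digraph_of)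
  have "subgraph (with_proj (digraph_of h)) (with_proj (digraph_of g))"
    using assms g.wf_digraph_axioms h.wf_digraph_axioms
    by (auto simp: subgraph_def compatible_def digraph_of_def bipartite_subgraph_def)
  then show ?thesis
    unfolding gdist_def g.\<mu>_def h.\<mu>_def
    by (intro INF_superset_mono) (auto intro: g.subgraph_awalk_imp_awalk)
qed

theorem lemma4:
  fixes G\<^sub>t g :: "'a bigraph" and k r :: nat and \<sigma> :: real and u\<^sub>q u\<^sub>i :: 'a
  assumes "0 < r" and "0 < k"
    and "bipartite_graph G\<^sub>t"
    and "bipartite_subgraph g G\<^sub>t"
    and "u\<^sub>q \<in> users g"
    and "u\<^sub>i \<in> users g"
    and "gdist g u\<^sub>i u\<^sub>q > ereal (2 * real r)"
  shows "\<not> (\<exists>h. bipartite_subgraph h g \<and> bitruss G\<^sub>t k r \<sigma> u\<^sub>q h \<and> u\<^sub>i \<in> users h)"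
proof
  assume "\<exists>h. bipartite_subgraph h g \<and> bitruss G\<^sub>t k r \<sigma> u\<^sub>q h \<and> u\<^sub>i \<in> users h"
  then obtain h where h: "bipartite_subgraph h g" "bitruss G\<^sub>t k r \<sigma> u\<^sub>q h" "u\<^sub>i \<in> users h"
    by blast
  have "bipartite_graph g"
    using h(1) by (simp add: bipartite_subgraph_def)
  \<comment> \<open>The assumption measures towards the center, the radius condition away from
    it.\<close>
  then have "gdist g u\<^sub>i u\<^sub>q \<le> gdist g u\<^sub>q u\<^sub>i"
    by (rule gdist_commute_le)
  also have "\<dots> \<le> gdist h u\<^sub>q u\<^sub>i"
    using h(1) by (rule gdist_subgraph_le)
  also have "\<dots> \<le> ereal (2 * real r)"
    using h(2,3) by (auto simp: bitruss_def)
  finally show False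
    using assms(7) by simp
qed

end
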